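(* For every integer $n\ge1$, $\pi((\times P)^n)\le 4^{n-1}+4\cdot 2^{n-1}$.
   Context: $P$ is the two-way infinite path with vertex set $\mathbb{Z}$ ($i\sim i+1$). $(\times P)^n$ is the $n$-fold tensor product of $P$: vertex set $\mathbb{Z}^n$, with $(x_1,\dots,x_n)\sim(y_1,\dots,y_n)$ iff $|x_j-y_j|=1$ for every $j$. A vertex coloring $c$ of a graph is non-repetitive if there is no path $v_1,\dots,v_{2k}$ ($k\ge1$, distinct vertices, consecutive ones adjacent) with $c(v_i)=c(v_{k+i})$ for all $1\le i\le k$; $\pi(G)$ denotes the minimum number of colors in a non-repetitive coloring of $G$. *)

theory Defs
  imports
    "Graph_Theory.Pair_Digraph"
    "Graph_Theory.Vertex_Walk"
    "HOL-Library.Extended_Nat"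
begin

text \<open>Undirected graphs, finite or infinite, are symmetric sets of arcs (pairs).\<close>

definition int_path :: "int pair_pre_digraph" where
  "int_path = \<lparr> pverts = UNIV, parcs = {(i, j). j = i + 1 \<or> i = j + 1} \<rparr>"

text \<open>The vertices of the \<open>n\<close>-fold tensor product are the lists of length \<open>n\<close> over the
  vertices of \<open>G\<close>. For \<open>n = 0\<close> it is a single vertex with a loop.\<close>

definition tensor_power :: "'a pair_pre_digraph \<Rightarrow> nat \<Rightarrow> 'a list pair_pre_digraph" where
  "tensor_power G n = (let V = {xs. length xs = n \<and> set xs \<subseteq> pverts G} in
     \<lparr> pverts = V,
       parcs = {(xs, ys). xs \<in> V \<and> ys \<in> V \<and> (\<forall>j<n. (xs ! j, ys ! j) \<in> parcs G)} \<rparr>)"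

definition nonrepetitive :: "'a pair_pre_digraph \<Rightarrow> ('a \<Rightarrow> 'c) \<Rightarrow> bool" where
  "nonrepetitive G c \<longleftrightarrow>
     \<not> (\<exists>vs k. k \<ge> 1 \<and> vpath vs (with_proj G) \<and> length vs = 2 * k \<and>
          (\<forall>i<k. c (vs ! i) = c (vs ! (k + i))))"

definition nonrep_colorable :: "'a pair_pre_digraph \<Rightarrow> nat \<Rightarrow> bool" where
  "nonrep_colorable G k \<longleftrightarrow> (\<exists>c. c ` pverts G \<subseteq> {..<k} \<and> nonrepetitive G c)"

text \<open>The value is \<open>\<infinity>\<close> if no finite number of colors suffices.\<close>

definition nonrep_number :: "'a pair_pre_digraph \<Rightarrow> enat" where
  "nonrep_number G = Inf {enat k | k. nonrep_colorable G k}"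

lemma pair_bidirected_int_path: "pair_bidirected_digraph int_path"
proof -
  have "sym (parcs int_path)" by (intro symI) (auto simp: int_path_def)
  then show ?thesis
    by unfold_locales (simp_all add: symmetric_def, auto simp: int_path_def)
qed

lemma pair_bidirected_tensor_power:
  assumes "pair_bidirected_digraph G" and "n \<ge> 1"
  shows "pair_bidirected_digraph (tensor_power G n)"
proof -
  have sym: "sym (parcs G)"
    and loops: "\<And>e. e \<in> parcs G \<Longrightarrow> fst e \<noteq> snd e"
    using assms(1)
    by (simp_all add: pair_bidirected_digraph_def pair_sym_digraph_def pair_sym_digraph_axioms_def
        pair_loopfree_digraph_def pair_loopfree_digraph_axioms_def symmetric_def)
  have "fst e \<noteq> snd e" if e: "e \<in> parcs (tensor_power G n)" for e
  proof -
    have "(fst e ! 0, snd e ! 0) \<in> parcs G"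
      using e assms(2) unfolding tensor_power_def Let_def by (auto simp: Suc_le_eq)
    from loops[OF this] show ?thesis by auto
  qed
  moreover have "sym (parcs (tensor_power G n))"
    using symD[OF sym] by (intro symI) (simp add: tensor_power_def Let_def)
  moreover have "fst e \<in> pverts (tensor_power G n) \<and> snd e \<in> pverts (tensor_power G n)"
    if "e \<in> parcs (tensor_power G n)" for e
    using that unfolding tensor_power_def Let_def by auto
  ultimately show ?thesis
    by unfold_locales (simp_all add: symmetric_def)
qed

lemma pverts_tensor_power_int_path: "pverts (tensor_power int_path n) = {xs. length xs = n}"
  by (auto simp: tensor_power_def int_path_def)

lemma parcs_tensor_power_int_path:
  "(xs, ys) \<in> parcs (tensor_power int_path n) \<longleftrightarrow>
     length xs = n \<and> length ys = n \<and> (\<forall>j<n. \<bar>xs ! j - ys ! j\<bar> = 1)"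
proof -
  have "(i, j) \<in> parcs int_path \<longleftrightarrow> \<bar>i - j\<bar> = 1" for i j
    by (auto simp: int_path_def)
  then show ?thesis
    by (auto simp: tensor_power_def Let_def int_path_def)
qed

lemma nonrep_number_le_iff: "nonrep_number G \<le> enat k \<longleftrightarrow> nonrep_colorable G k"
proof
  assume le: "nonrep_number G \<le> enat k"
  let ?S = "{enat k | k. nonrep_colorable G k}"
  have "?S \<noteq> {}"
    using le by (auto simp: nonrep_number_def Inf_enat_def split: if_splits)
  then have "Inf ?S \<in> ?S"
    unfolding Inf_enat_def by (auto intro: LeastI)
  then obtain m where m: "nonrep_number G = enat m" "nonrep_colorable G m"
    by (auto simp: nonrep_number_def)
  with le have "m \<le> k" by simp
  then have "{..<m} \<subseteq> {..<k}" by auto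
  with m(2) show "nonrep_colorable G k"
    unfolding nonrep_colorable_def by (meson subset_trans)
next
  assume "nonrep_colorable G k"
  then show "nonrep_number G \<le> enat k"
    unfolding nonrep_number_def by (auto intro: Inf_lower)
qed

end

theory Submission
  imports Defs
begin

text \<open>Call a sequence on the integers locally injective if terms at distance 1 or 2 differ. If it
  is also square-free, then two halves of a lazy walk that read the same colors move in parallel, or
  in opposite directions, because the colors determine the moves up to one global sign; a
  translation by a nonzero amount would give a square, and a reflection would force the halves to
  meet. Hence such halves agree at all times. Four colors suffice: take the differences of the
  two-sided Thue--Morse word and insert a fourth letter at every third place.

  A path in the tensor product alternates between vertices with even and odd first coordinate. At
  the even ones we use the four-coloring for the coordinates \<open>2, \<dots>, n\<close>, at the odd ones only for
  the first coordinate. In a repetition, the other coordinates at an odd time are then known up to an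
  error of 2 from a neighboring even time, so one bit per coordinate determines them. In both
  cases a coordinate changes by \<open>0\<close> or \<open>\<plusminus>2\<close> between times of the same parity, so after halving it
  performs a lazy walk.\<close>

section \<open>The two-sided Thue--Morse word\<close>

fun thue_morse :: "nat \<Rightarrow> bool" where
  "thue_morse n = (if n = 0 then False else thue_morse (n div 2) \<noteq> odd n)"

declare thue_morse.simps [simp del]

lemma thue_morse_double: "thue_morse (2 * n) = thue_morse n"
  by (subst thue_morse.simps) (auto simp: thue_morse.simps[of 0])

lemma thue_morse_double_Suc: "thue_morse (Suc (2 * n)) = (\<not> thue_morse n)"
  by (subst thue_morse.simps) auto

text \<open>The left half mirrors the right half about -1/2. This reflection maps pairs of positions
  2m, 2m+1 to such pairs, so the two letters of a pair differ on both sides.\<close>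

definition thue_morse_int :: "int \<Rightarrow> bool" where
  "thue_morse_int i = thue_morse (nat (if i \<ge> 0 then i else - 1 - i))"

lemma thue_morse_int_double: "thue_morse_int (2 * i) = (thue_morse_int i = (i \<ge> 0))"
proof (cases "i \<ge> 0")
  case True
  then show ?thesis
    by (simp add: thue_morse_int_def nat_mult_distrib thue_morse_double)
next
  case False
  then have "nat (- 1 - 2 * i) = Suc (2 * nat (- 1 - i))" by simp
  with False show ?thesis
    by (simp add: thue_morse_int_def thue_morse_double_Suc)
qed

lemma thue_morse_int_double_plus1: "thue_morse_int (2 * i + 1) = (\<not> thue_morse_int (2 * i))"
proof (cases "i \<ge> 0")
  case True
  then have "nat (2 * i + 1) = Suc (2 * nat i)" by simp
  with True show ?thesis
    by (simp add: thue_morse_int_double thue_morse_int_def[of "2 * i + 1"]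
        thue_morse_int_def[of i] thue_morse_double_Suc)
next
  case False
  then have "nat (- 1 - (2 * i + 1)) = 2 * nat (- 1 - i)" by simp
  with False show ?thesis
    by (simp add: thue_morse_int_double thue_morse_int_def[of "2 * i + 1"]
        thue_morse_int_def[of i] thue_morse_double)
qed

text \<open>The bound on \<open>i\<close> is inclusive: the factor is a square of period
  \<open>p\<close> followed by one more letter.\<close>

definition overlap :: "(int \<Rightarrow> 'a) \<Rightarrow> int \<Rightarrow> int \<Rightarrow> bool" where
  "overlap s x p \<longleftrightarrow> (\<forall>i. 0 \<le> i \<and> i \<le> p \<longrightarrow> s (x + i) = s (x + p + i))"

text \<open>As \<open>p\<close> is odd, one of \<open>x + i\<close> and \<open>x + p + i\<close> is
  even and hence begins a pair of distinct letters. So the letters alternate from \<open>x\<close>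
  to \<open>x + p\<close>, an odd distance, and the two ends differ.\<close>

lemma no_odd_overlap:
  assumes s: "\<And>m. s (2 * m + 1) = (\<not> s (2 * m))" and p: "odd p" "p \<ge> 1"
  shows "\<not> overlap s x p"
proof
  assume ov: "overlap s x p"
  have even: "s (y + 1) = (\<not> s y)" if "even y" for y
    using s that by (auto elim: evenE)
  have alt: "s (x + (i + 1)) = (\<not> s (x + i))" if i: "0 \<le> i" "i < p" for i
  proof (cases "even (x + i)")
    case True
    then show ?thesis using even[of "x + i"] by (simp add: add.assoc)
  next
    case False
    then have "s (x + p + i + 1) = (\<not> s (x + p + i))" using p by (intro even) simp
    moreover have "s (x + (i + 1)) = s (x + p + (i + 1))" "s (x + i) = s (x + p + i)"
      using ov i unfolding overlap_def by auto
    ultimately show ?thesis by (simp add: add.assoc)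
  qed
  have "int j \<le> p \<Longrightarrow> s (x + int j) = (s x = even j)" for j
  proof (induction j)
    case (Suc j)
    then show ?case using alt[of "int j"] by (simp add: add.commute)
  qed simp
  from this[of "nat p"] p have "s (x + p) = (\<not> s x)"
    by (simp add: even_nat_iff)
  with ov[unfolded overlap_def, rule_format, of 0] p show False by simp
qed

text \<open>Letters at positions 2m and 2m+1 determine each other, so equalities at odd positions
  carry over to the even positions just before them.\<close>

lemma even_overlap_halved:
  assumes s: "\<And>m. s (2 * m + 1) = (\<not> s (2 * m))" and ov: "overlap s x (2 * q)"
  shows "overlap (\<lambda>m. s (2 * m)) (x div 2) q"
  unfolding overlap_def
proof (intro allI impI)
  fix i assume "0 \<le> i \<and> i \<le> q"
  with ov have eq: "s (x + 2 * i) = s (x + 2 * q + 2 * i)" by (auto simp: overlap_def)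
  show "s (2 * (x div 2 + i)) = s (2 * (x div 2 + q + i))"
  proof (cases "even x")
    case True
    with eq show ?thesis by (simp add: algebra_simps)
  next
    case False
    then have "x + 2 * i = 2 * (x div 2 + i) + 1" "x + 2 * q + 2 * i = 2 * (x div 2 + q + i) + 1"
      by presburger+
    with eq s show ?thesis by metis
  qed
qed

text \<open>The left half of the word is not a fixed point of the Thue--Morse morphism, only of its
  square, so the descent alternates between two words.\<close>

lemma thue_morse_int_overlap_free_aux:
  "\<not> overlap thue_morse_int x (int (Suc p)) \<and> \<not> overlap (\<lambda>m. thue_morse_int (2 * m)) x (int (Suc p))"
proof (induction p arbitrary: x rule: less_induct)
  case (less p)
  let ?u = "\<lambda>m. thue_morse_int (2 * m)"
  have t: "\<And>m. thue_morse_int (2 * m + 1) = (\<not> thue_morse_int (2 * m))"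
    by (rule thue_morse_int_double_plus1)
  have u: "?u (2 * m + 1) = (\<not> ?u (2 * m))" for m
  proof -
    have "0 \<le> 2 * m + 1 \<longleftrightarrow> 0 \<le> 2 * m" by presburger
    then show ?thesis
      unfolding thue_morse_int_double[of "2 * m + 1"] thue_morse_int_double[of "2 * m"] t by blast
  qed
  \<comment> \<open>Sampling at even positions complements the letters at negative positions, and
    doing it twice restores them.\<close>
  have uu: "(\<lambda>m. ?u (2 * m)) = thue_morse_int"
  proof
    fix m :: int
    have "0 \<le> 2 * m \<longleftrightarrow> 0 \<le> m" by presburger
    then show "?u (2 * m) = thue_morse_int m"
      unfolding thue_morse_int_double[of "2 * m"] thue_morse_int_double[of m] by blast
  qed
  show ?case
  proof (cases "even (Suc p)")
    case True
    then obtain q where "Suc p = 2 * q" using evenE by blast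
    then obtain r where r: "int (Suc p) = 2 * int (Suc r)" "r < p" by (cases q) auto
    show ?thesis
      unfolding r(1)
      using less[OF r(2)] even_overlap_halved[where s = thue_morse_int, OF t]
        even_overlap_halved[where s = ?u, OF u, unfolded uu] by blast
  next
    case False
    then show ?thesis using no_odd_overlap[where s = thue_morse_int, OF t] no_odd_overlap[where s = ?u, OF u]
      by simp
  qed
qed

lemma thue_morse_int_overlap_free: "p \<ge> 1 \<Longrightarrow> \<not> overlap thue_morse_int x p"
  using thue_morse_int_overlap_free_aux[of x "nat p - 1"] by simp

section \<open>A square-free and locally injective word on four letters\<close>

definition square_free :: "(int \<Rightarrow> 'a) \<Rightarrow> bool" where
  "square_free s \<longleftrightarrow> (\<forall>x p. p \<ge> 1 \<longrightarrow> (\<exists>i. 0 \<le> i \<and> i < p \<and> s (x + i) \<noteq> s (x + p + i)))"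

lemma square_free_neq_next: "square_free s \<Longrightarrow> s x \<noteq> s (x + 1)"
  unfolding square_free_def
  by (drule spec[of _ x], drule spec[of _ 1]) (auto simp: zle_add1_eq_le[of _ 0, simplified])

text \<open>The letters 1, 2, 3 encode the differences 0, -1, 1 of consecutive Thue-Morse letters; 0
  is kept free for the fourth letter.\<close>

definition ternary :: "int \<Rightarrow> nat" where
  "ternary i = (if thue_morse_int (i + 1) = thue_morse_int i then 1
     else if thue_morse_int i then 2 else 3)"

text \<open>A square in the differences means that \<open>t (x + p + i) - t (x + i)\<close> is constant for
  \<open>0 \<le> i \<le> p\<close>; nonzero constants are impossible for a word with values in \<open>{0, 1}\<close>.\<close>

lemma square_free_ternary: "square_free ternary"
proof (rule ccontr)
  define t :: "int \<Rightarrow> int" where "t i = of_bool (thue_morse_int i)" for i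
  have tern: "ternary i = ternary j \<longleftrightarrow> t (i + 1) - t i = t (j + 1) - t j" for i j
    by (auto simp: ternary_def t_def)
  have range: "0 \<le> t i" "t i \<le> 1" for i by (simp_all add: t_def)
  assume "\<not> square_free ternary"
  then obtain x p where p: "p \<ge> 1"
    and sq: "\<And>i. 0 \<le> i \<Longrightarrow> i < p \<Longrightarrow> ternary (x + i) = ternary (x + p + i)"
    unfolding square_free_def by blast
  have const: "int j \<le> p \<Longrightarrow> t (x + p + int j) - t (x + int j) = t (x + p) - t x" for j
  proof (induction j)
    case (Suc j)
    then have "t (x + int j + 1) - t (x + int j) = t (x + p + int j + 1) - t (x + p + int j)"
      using sq[of "int j"] tern by simp
    with Suc show ?case by (simp add: algebra_simps)
  qed simp
  \<comment> \<open>The terms at \<open>x\<close>, \<open>x + p\<close>, \<open>x + 2 * p\<close>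
    form an arithmetic progression inside {0, 1}, so it is constant.\<close>
  have "t (x + p + p) - t (x + p) = t (x + p) - t x"
    using const[of "nat p"] p by simp
  then have "t (x + p) = t x"
    using range[of "x + p + p"] range[of "x + p"] range[of x] by linarith
  then have "t (x + p + i) = t (x + i)" if "0 \<le> i" "i \<le> p" for i
    using const[of "nat i"] that by simp
  then have "overlap thue_morse_int x p"
    unfolding overlap_def t_def by (metis of_bool_eq_iff)
  with p thue_morse_int_overlap_free show False by blast
qed

text \<open>The argument of \<open>ternary\<close> is the rank of \<open>i\<close> among the
  integers not divisible by 3, where 1 has rank 0.\<close>

definition quaternary :: "int \<Rightarrow> nat" where
  "quaternary i = (if i mod 3 = 0 then 0 else ternary (2 * (i div 3) + i mod 3 - 1))"

lemma ternary_pos: "ternary i > 0"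
  by (simp add: ternary_def)

lemma quaternary_less: "quaternary i < 4"
  by (simp add: quaternary_def ternary_def)

lemma quaternary_0_iff: "quaternary i = 0 \<longleftrightarrow> i mod 3 = 0"
  using ternary_pos by (auto simp: quaternary_def)

lemma ternary_eq_quaternary: "ternary j = quaternary (3 * (j div 2) + 1 + j mod 2)"
proof -
  have "(3 * (j div 2) + 1 + j mod 2) mod 3 = 1 + j mod 2"
    "(3 * (j div 2) + 1 + j mod 2) div 3 = j div 2"
    by presburger+
  moreover have "2 * (j div 2) + (1 + j mod 2) - 1 = j" by simp
  moreover have "1 + j mod 2 \<noteq> 0" by presburger
  ultimately show ?thesis unfolding quaternary_def by presburger
qed

definition locally_injective :: "(int \<Rightarrow> 'a) \<Rightarrow> bool" where
  "locally_injective s \<longleftrightarrow> (\<forall>x y. \<bar>x - y\<bar> \<le> 2 \<longrightarrow> s x = s y \<longrightarrow> x = y)"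

text \<open>Zeros are 3 apart. Equal nonzero letters at distance 1 or 2 would come from adjacent
  letters of \<open>ternary\<close>, which differ by square-freeness.\<close>

lemma locally_injective_quaternary: "locally_injective quaternary"
proof -
  have less: "quaternary x \<noteq> quaternary y" if "x < y" "y \<le> x + 2" for x y
  proof
    assume eq: "quaternary x = quaternary y"
    then have "x mod 3 = 0 \<longleftrightarrow> y mod 3 = 0" using quaternary_0_iff by metis
    with that have nz: "x mod 3 \<noteq> 0" "y mod 3 \<noteq> 0" by presburger+
    let ?j = "\<lambda>i :: int. 2 * (i div 3) + i mod 3 - 1"
    have "y = x + 1 \<or> y = x + 2" using that by presburger
    then have "y = x + 1 \<and> x mod 3 = 1 \<or> y = x + 2 \<and> x mod 3 = 2"
      using nz by presburger
    then have "?j y = ?j x + 1"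
    proof (elim disjE conjE)
      assume y: "y = x + 1" and x: "x mod 3 = 1"
      from x have "(x + 1) div 3 = x div 3" "(x + 1) mod 3 = 2" by presburger+
      with x y show ?thesis by simp
    next
      assume y: "y = x + 2" and x: "x mod 3 = 2"
      from x have "(x + 2) div 3 = x div 3 + 1" "(x + 2) mod 3 = 1" by presburger+
      with x y show ?thesis by simp
    qed
    moreover have "ternary (?j x) = ternary (?j y)"
      using eq nz by (simp add: quaternary_def)
    ultimately show False
      using square_free_neq_next[OF square_free_ternary, of "?j x"] by simp
  qed
  show ?thesis
    unfolding locally_injective_def
  proof (intro allI impI)
    fix x y :: int assume "\<bar>x - y\<bar> \<le> 2" "quaternary x = quaternary y"
    with less[of x y] less[of y x] show "x = y" by linarith
  qed
qed

text \<open>A square has period at least 3 by local injectivity, so its first half contains a zero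
  and 3 divides \<open>p\<close>. Deleting the zeros leaves a square of period 2p/3 in
  \<open>ternary\<close>.\<close>

lemma square_free_quaternary: "square_free quaternary"
proof (rule ccontr)
  assume "\<not> square_free quaternary"
  then obtain x p where p: "p \<ge> 1"
    and sq: "\<And>i. 0 \<le> i \<Longrightarrow> i < p \<Longrightarrow> quaternary (x + i) = quaternary (x + p + i)"
    unfolding square_free_def by blast
  have "p \<ge> 3"
  proof (rule ccontr)
    assume "\<not> p \<ge> 3"
    then have "x = x + p"
      using locally_injective_quaternary[unfolded locally_injective_def, rule_format, of x "x + p"]
        sq[of 0] p by simp
    with p show False by simp
  qed
  define i where "i = (- x) mod 3"
  have i: "0 \<le> i" "i < 3" "(x + i) mod 3 = 0"
    unfolding i_def by presburger+
  with sq[of i] \<open>p \<ge> 3\<close> have "(x + p + i) mod 3 = 0"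
    using quaternary_0_iff by (metis less_le_trans)
  with i(3) have "p mod 3 = 0" by presburger
  then obtain q where q: "p = 3 * q" by auto
  \<comment> \<open>The first letter of \<open>ternary\<close> placed at or after
    \<open>x\<close>.\<close>
  define y where "y = 2 * (x div 3) + (if x mod 3 = 2 then 1 else 0)"
  have "ternary (y + e) = ternary (y + 2 * q + e)" if e: "0 \<le> e" "e < 2 * q" for e
  proof -
    define z where "z = 3 * ((y + e) div 2) + 1 + (y + e) mod 2"
    have "x \<le> z" "z < x + 3 * q"
      using e unfolding z_def y_def by (cases "x mod 3 = 2"; simp; presburger)+
    with sq[of "z - x"] q have "quaternary z = quaternary (z + 3 * q)"
      by (simp add: add.commute)
    moreover have "(y + 2 * q + e) div 2 = (y + e) div 2 + q" "(y + 2 * q + e) mod 2 = (y + e) mod 2"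
      by presburger+
    then have "3 * ((y + 2 * q + e) div 2) + 1 + (y + 2 * q + e) mod 2 = z + 3 * q"
      by (simp add: z_def)
    then have "ternary (y + 2 * q + e) = quaternary (z + 3 * q)"
      by (subst ternary_eq_quaternary) (rule arg_cong)
    moreover have "ternary (y + e) = quaternary z"
      unfolding z_def by (rule ternary_eq_quaternary)
    ultimately show ?thesis by (simp only:)
  qed
  then show False
    using square_free_ternary[unfolded square_free_def, rule_format, of "2 * q" y] p q by auto
qed

section \<open>Lazy walks with a repeated color sequence\<close>

lemma lazy_walk_ivt:
  fixes u :: "nat \<Rightarrow> int"
  assumes lazy: "\<And>i. i < m \<Longrightarrow> \<bar>u (Suc i) - u i\<bar> \<le> 1"
    and between: "u 0 \<le> y \<and> y \<le> u m \<or> u m \<le> y \<and> y \<le> u 0"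
  obtains i where "i \<le> m" "u i = y"
  using between
proof
  assume "u 0 \<le> y \<and> y \<le> u m"
  then show ?thesis
    using nat0_intermed_int_val[of m u y] lazy that by auto
next
  assume "u m \<le> y \<and> y \<le> u 0"
  then show ?thesis
    using nat0_intermed_int_val[of m "\<lambda>i. - u i" "- y"] lazy that
    by (auto simp: abs_minus_commute)
qed

text \<open>For positions at distance at most 2, colors tell whether they coincide. Once
  \<open>u\<close> has moved, it has visited a neighbor of its current position; comparing the next
  color with those two identifies the next move, and likewise for \<open>v\<close>.\<close>

lemma lazy_walks_same_colors:
  fixes u v :: "nat \<Rightarrow> int"
  assumes inj: "locally_injective f"
    and u: "\<And>i. i < m \<Longrightarrow> \<bar>u (Suc i) - u i\<bar> \<le> 1"
    and v: "\<And>i. i < m \<Longrightarrow> \<bar>v (Suc i) - v i\<bar> \<le> 1"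
    and eq: "\<And>i. i \<le> m \<Longrightarrow> f (u i) = f (v i)"
  shows "\<exists>s. \<bar>s\<bar> = 1 \<and> (\<forall>i\<le>m. v i - v 0 = s * (u i - u 0))"
  using u v eq
proof (induction m)
  case 0
  show ?case by (intro exI[of _ 1]) simp
next
  case (Suc m)
  have inj': "x = y" if "f x = f y" "\<bar>x - y\<bar> \<le> 2" for x y
    using inj that unfolding locally_injective_def by blast
  obtain s where s: "\<bar>s\<bar> = 1" and IH: "\<And>i. i \<le> m \<Longrightarrow> v i - v 0 = s * (u i - u 0)"
    using Suc.IH[OF Suc.prems] by auto
  have su: "\<bar>u (Suc m) - u m\<bar> \<le> 1" and sv: "\<bar>v (Suc m) - v m\<bar> \<le> 1"
    using Suc.prems by auto
  have cm: "f (u m) = f (v m)" and cS: "f (u (Suc m)) = f (v (Suc m))"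
    using Suc.prems by auto
  have extend: "?case" if "\<bar>r\<bar> = 1" "\<And>i. i \<le> m \<Longrightarrow> v i - v 0 = r * (u i - u 0)"
      "v (Suc m) - v m = r * (u (Suc m) - u m)" for r
  proof -
    have "v (Suc m) - v 0 = r * (u (Suc m) - u 0)"
      using that(2)[of m] that(3) by (simp add: algebra_simps)
    with that(1,2) show ?thesis by (intro exI[of _ r] conjI allI impI) (metis le_Suc_eq)+
  qed
  have still: "u (Suc m) = u m \<longleftrightarrow> v (Suc m) = v m"
  proof
    assume "u (Suc m) = u m"
    then have "f (v (Suc m)) = f (v m)" using cm cS by metis
    then show "v (Suc m) = v m" by (rule inj') (use sv in linarith)
  next
    assume "v (Suc m) = v m"
    then have "f (u (Suc m)) = f (u m)" using cm cS by metis
    then show "u (Suc m) = u m" by (rule inj') (use su in linarith)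
  qed
  show ?case
  proof (cases "\<forall>i\<le>m. u i = u 0")
    case True
    have const: "u i - u 0 = 0" "v i - v 0 = 0" if "i \<le> m" for i
      using IH[OF that] spec[OF True, of i] that by simp_all
    show ?thesis
    proof (cases "u (Suc m) = u m")
      case True
      then have "v (Suc m) = v m" using still by blast
      with True show ?thesis
        by (intro extend[of 1]) (simp_all only: const abs_one mult_zero_right diff_self)
    next
      case False
      with still have "v (Suc m) \<noteq> v m" by blast
      with False su sv have a: "\<bar>u (Suc m) - u m\<bar> = 1" "\<bar>v (Suc m) - v m\<bar> = 1" by linarith+
      \<comment> \<open>This is the first move, so it fixes the sign. Both moves are 1 or -1, so
        their product is their quotient.\<close>
      show ?thesis
      proof (rule extend[of "(v (Suc m) - v m) * (u (Suc m) - u m)"])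
        have "(u (Suc m) - u m) * (u (Suc m) - u m) = 1"
          using a by (metis abs_mult_self_eq mult_1)
        then show "v (Suc m) - v m = (v (Suc m) - v m) * (u (Suc m) - u m) * (u (Suc m) - u m)"
          by (metis mult.assoc mult.right_neutral)
      qed (simp_all only: a const abs_mult mult_zero_right mult_1)
    qed
  next
    case False
    then obtain l where l: "l \<le> m" "u l \<noteq> u m" by (metis le0)
    \<comment> \<open>The neighbor of \<open>u m\<close> on the side of \<open>u l\<close>; the walk
      passes it between times \<open>l\<close> and \<open>m\<close>.\<close>
    define y where "y = (if u l < u m then u m - 1 else u m + 1)"
    obtain i where i: "i \<le> m - l" "u (l + i) = y"
      by (rule lazy_walk_ivt[of "m - l" "\<lambda>i. u (l + i)" y])
        (use l Suc.prems(1) in \<open>auto simp: y_def\<close>)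
    define j where "j = l + i"
    have j: "j \<le> m" "\<bar>u j - u m\<bar> = 1" "u j = y"
      using i l by (auto simp: j_def y_def)
    have vj: "v j - v m = s * (u j - u m)"
      using IH[of j] IH[of m] j by (simp add: algebra_simps)
    then have avj: "\<bar>v j - v m\<bar> = 1" using s j by (simp add: abs_mult)
    have cj: "f (u j) = f (v j)" using Suc.prems(3)[of j] j by simp
    have revisit: "u (Suc m) = u j \<longleftrightarrow> v (Suc m) = v j"
    proof
      assume "u (Suc m) = u j"
      then have "f (v (Suc m)) = f (v j)" using cj cS by metis
      then show "v (Suc m) = v j" by (rule inj') (use sv avj in linarith)
    next
      assume "v (Suc m) = v j"
      then have "f (u (Suc m)) = f (u j)" using cj cS by metis
      then show "u (Suc m) = u j" by (rule inj') (use su j(2) in linarith)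
    qed
    have "v (Suc m) - v m = s * (u (Suc m) - u m)"
    proof -
      \<comment> \<open>Stay, return to the visited neighbor, or move to the opposite one.\<close>
      consider "u (Suc m) = u m" | "u (Suc m) = u j"
        | "u (Suc m) - u m = - (u j - u m)" "u (Suc m) \<noteq> u m" "u (Suc m) \<noteq> u j"
        using su j(2) by linarith
      then show ?thesis
      proof cases
        case 3
        with still revisit sv avj have "v (Suc m) - v m = - (v j - v m)" by linarith
        with 3(1) vj show ?thesis by (simp only: mult_minus_right)
      qed (use still revisit vj in auto)
    qed
    with s IH show ?thesis by (intro extend)
  qed
qed

lemma repetitive_lazy_walk_boring:
  fixes w :: "nat \<Rightarrow> int"
  assumes inj: "locally_injective f" and sf: "square_free f"
    and lazy: "\<And>i. Suc i < 2 * k \<Longrightarrow> \<bar>w (Suc i) - w i\<bar> \<le> 1"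
    and rep: "\<And>i. i < k \<Longrightarrow> f (w i) = f (w (k + i))"
    and i: "i < k"
  shows "w i = w (k + i)"
proof -
  obtain m where k: "k = Suc m" using i by (cases k) auto
  define u where "u = w"
  define v where "v = (\<lambda>i. w (k + i))"
  have inj': "x = y" if "f x = f y" "\<bar>x - y\<bar> \<le> 2" for x y
    using inj that unfolding locally_injective_def by blast
  have fuv: "f (u i) = f (v i)" if "i \<le> m" for i
    using rep that by (simp add: u_def v_def k)
  have lu: "\<bar>u (Suc i) - u i\<bar> \<le> 1" if "i < k" for i
    using lazy[of i] that i by (simp add: u_def)
  have lv: "\<bar>v (Suc i) - v i\<bar> \<le> 1" if "i < m" for i
    using lazy[of "k + i"] that by (simp add: v_def k)
  have join: "u k = v 0" by (simp add: u_def v_def)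
  obtain s where s: "\<bar>s\<bar> = 1" and sv: "\<And>i. i \<le> m \<Longrightarrow> v i - v 0 = s * (u i - u 0)"
    using lazy_walks_same_colors[OF inj, of m u v] lu lv fuv k by (metis less_SucI)
  have last: "\<bar>v 0 - u m\<bar> \<le> 1" using lu[of m] join k by simp
  have lum: "\<bar>u (Suc i) - u i\<bar> \<le> 1" if "i < m" for i using lu that k by simp
  have "u 0 = v 0"
  proof (cases "s = 1")
    case True
    define d where "d = v 0 - u 0"
    have shift: "v i = u i + d" if "i \<le> m" for i
      using sv[OF that] True by (simp add: d_def)
    \<comment> \<open>In parallel motion the first half visits every such \<open>y\<close>, and the
      second half is then at \<open>y + d\<close>. As \<open>u m\<close> is within 1 of
      \<open>u 0 + d\<close>, this covers enough values for a square of period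
      \<open>abs d\<close>.\<close>
    have fshift: "f y = f (y + d)" if y: "u 0 \<le> y \<and> y \<le> u m \<or> u m \<le> y \<and> y \<le> u 0" for y
    proof -
      obtain i where "i \<le> m" "u i = y" using lazy_walk_ivt[OF lum y] .
      with fuv shift show ?thesis by metis
    qed
    show ?thesis
    proof (rule ccontr)
      assume "u 0 \<noteq> v 0"
      then consider "d \<ge> 1" | "- d \<ge> 1" by (fastforce simp: d_def)
      then show False
      proof cases
        case 1
        then obtain e where "0 \<le> e" "e < d" "f (u 0 + e) \<noteq> f (u 0 + d + e)"
          using sf unfolding square_free_def by blast
        moreover have "u m \<ge> u 0 + d - 1" using last by (simp add: d_def)
        ultimately show False using fshift[of "u 0 + e"] by (simp add: algebra_simps)
      next
        case 2
        \<comment> \<open>For negative \<open>d\<close>, the square ends at \<open>u 0\<close> and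
          has length \<open>- 2 * d\<close>, which gives its start.\<close>
        let ?x = "u 0 + 2 * d + 1"
        from 2 obtain e where "0 \<le> e" "e < - d" "f (?x + e) \<noteq> f (?x + - d + e)"
          using sf unfolding square_free_def by blast
        moreover have "u m \<le> u 0 + d + 1" using last by (simp add: d_def)
        ultimately show False using fshift[of "?x - d + e"] by (simp add: algebra_simps)
      qed
    qed
  next
    case False
    with s have s: "s = - 1" by linarith
    \<comment> \<open>In opposite motion the sum of the positions is constant, so when
      \<open>u\<close> reaches the rounded midpoint of \<open>u 0\<close> and \<open>v 0\<close>,
      \<open>v\<close> is within 1 of it.\<close>
    define h where "h = (u 0 + v 0) div 2"
    obtain i where i: "i \<le> k" "u i = h"
      by (rule lazy_walk_ivt[of k u h]) (use lu join in \<open>auto simp: h_def\<close>)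
    have "\<exists>i\<le>m. \<bar>u i - v i\<bar> \<le> 1"
    \<comment> \<open>The reflection is known only up to time \<open>m\<close>. If the midpoint is
      hit at time \<open>k\<close>, it equals \<open>v 0\<close>, and the starting points are
      already close.\<close>
    proof (cases "i = k")
      case True
      with i join have "(u 0 + v 0) div 2 = v 0" by (simp add: h_def)
      then have "\<bar>u 0 - v 0\<bar> \<le> 1" by linarith
      then show ?thesis by blast
    next
      case False
      with i k have "i \<le> m" by simp
      moreover from this have "v i = u 0 + v 0 - u i" using sv[of i] s by simp
      then have "\<bar>u i - v i\<bar> \<le> 1" using i unfolding h_def by linarith
      ultimately show ?thesis by blast
    qed
    then obtain j where j: "j \<le> m" "u j = v j" using inj' fuv by force
    \<comment> \<open>Backwards from the meeting time: one step earlier the walks are at most 2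
      apart and have the same color.\<close>
    have "u j' = v j'" if "j' \<le> j" for j'
      using that
    proof (induction rule: inc_induct)
      case base
      then show ?case using j by simp
    next
      case (step n)
      then have n: "n < m" using j by simp
      have "\<bar>u n - v n\<bar> \<le> 2" using lum[OF n] lv[OF n] step.IH by linarith
      with inj' fuv[of n] n show ?case by simp
    qed
    then show ?thesis by blast
  qed
  moreover have "u i = v i" if "i \<le> m" "u 0 = v 0" for i
    using that
  proof (induction i)
    case (Suc i)
    have "\<bar>u (Suc i) - v (Suc i)\<bar> \<le> 2"
      using lum[of i] lv[of i] Suc by simp
    with inj' fuv Suc show ?case by simp
  qed simp
  ultimately show ?thesis using i k by (simp add: u_def v_def)
qed

section \<open>Coloring the tensor product\<close>

lemma nonrep_colorable_card:
  assumes "c ` pverts G \<subseteq> S" "finite S" "nonrepetitive G c"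
  shows "nonrep_colorable G (card S)"
proof -
  obtain h where h: "bij_betw h S {..<card S}"
    using ex_bij_betw_finite_nat[OF \<open>finite S\<close>] by (auto simp: atLeast0LessThan)
  have "(h \<circ> c) ` pverts G \<subseteq> {..<card S}"
    using assms(1) h by (auto simp: bij_betw_def)
  moreover have "nonrepetitive G (h \<circ> c)"
    unfolding nonrepetitive_def
  proof (intro notI, elim exE conjE)
    fix vs k
    assume vs: "1 \<le> k" "vpath vs (with_proj G)" "length vs = 2 * k"
      and eq: "\<forall>i<k. (h \<circ> c) (vs ! i) = (h \<circ> c) (vs ! (k + i))"
    have "set vs \<subseteq> pverts G"
      using vs(2) by (auto simp: vpath_def vwalk_def)
    then have "c (vs ! i) \<in> S" if "i < 2 * k" for i
      using that vs(3) assms(1) nth_mem[of i vs] by (auto simp: subset_iff)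
    then have "c (vs ! i) = c (vs ! (k + i))" if "i < k" for i
      using eq[rule_format, OF that] that bij_betw_imp_inj_on[OF h]
      by (intro inj_onD[of h S]) simp_all
    with assms(3) vs show False unfolding nonrepetitive_def by blast
  qed
  ultimately show ?thesis unfolding nonrep_colorable_def by blast
qed

text \<open>The two summands of the type yield the two terms of the bound. At odd vertices, the
  parity of \<open>y div 2\<close> separates values of \<open>y\<close> that differ by exactly
  2.\<close>

definition tensor_color :: "int list \<Rightarrow> nat list + nat \<times> bool list" where
  "tensor_color xs = (if even (hd xs)
     then Inl (map (\<lambda>y. quaternary (y div 2)) (tl xs))
     else Inr (quaternary (hd xs div 2), map (\<lambda>y. even (y div 2)) (tl xs)))"

lemma vwalk_nth_arc:
  assumes "vwalk vs G" "Suc i < length vs"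
  shows "(vs ! i, vs ! Suc i) \<in> arcs_ends G"
  using assms
proof (induction vs arbitrary: i rule: vwalk_arcs.induct)
  case (3 x y xs)
  then show ?case by (cases i) (auto simp: vwalk_def)
qed auto

lemma nonrepetitive_tensor_color:
  assumes n: "n \<ge> 1"
  shows "nonrepetitive (tensor_power int_path n) tensor_color"
  unfolding nonrepetitive_def
proof (intro notI, elim exE conjE)
  fix vs k
  let ?G = "tensor_power int_path n"
  assume k: "1 \<le> k" and path: "vpath vs (with_proj ?G)" and len: "length vs = 2 * k"
    and rep: "\<forall>i<k. tensor_color (vs ! i) = tensor_color (vs ! (k + i))"
  define w where "w i j = vs ! i ! j" for i j
  have length: "length (vs ! i) = n" if "i < 2 * k" for i
  proof -
    have "vs ! i \<in> pverts ?G"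
      using path that len by (auto simp: vpath_def vwalk_def)
    then show ?thesis by (simp add: pverts_tensor_power_int_path)
  qed
  have step: "\<bar>w (Suc i) j - w i j\<bar> = 1" if "Suc i < 2 * k" "j < n" for i j
  proof -
    have "(vs ! i, vs ! Suc i) \<in> parcs ?G"
      using vwalk_nth_arc[of vs "with_proj ?G" i] path that len by (simp add: vpath_def)
    then show ?thesis
      using that by (simp add: parcs_tensor_power_int_path w_def abs_minus_commute)
  qed
  have hd: "hd (vs ! i) = w i 0" if "i < 2 * k" for i
    using length[OF that] n by (cases "vs ! i") (auto simp: w_def)
  have tl: "map g (tl (vs ! i)) = map g (tl (vs ! i')) \<longleftrightarrow> (\<forall>j. 1 \<le> j \<and> j < n \<longrightarrow> g (w i j) = g (w i' j))"
    if "i < 2 * k" "i' < 2 * k" for g :: "int \<Rightarrow> 'b" and i i'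
  proof -
    have "(\<forall>j<n - 1. g (w i (Suc j)) = g (w i' (Suc j))) \<longleftrightarrow>
        (\<forall>j. 1 \<le> j \<and> j < n \<longrightarrow> g (w i j) = g (w i' j))"
    proof safe
      fix j assume *: "\<forall>j<n - 1. g (w i (Suc j)) = g (w i' (Suc j))" and "1 \<le> j" "j < n"
      then show "g (w i j) = g (w i' j)" using spec[OF *, of "j - 1"] by simp
    qed auto
    then show ?thesis
      using length[OF that(1)] length[OF that(2)]
      by (auto simp: list_eq_iff_nth_eq nth_tl w_def)
  qed
  have parity: "even (w i j) \<longleftrightarrow> (even (w 0 j) = even i)" if "i < 2 * k" "j < n" for i j
    using that(1)
  proof (induction i)
    case (Suc i)
    have "even (w (Suc i) j) \<longleftrightarrow> odd (w i j)" using step[of i j] Suc.prems that(2) by presburger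
    with Suc show ?case by auto
  qed simp
  \<comment> \<open>The constructor of the color reveals the parity of the first coordinate, which
    flips at every step; hence \<open>k\<close> is even.\<close>
  have "even (w 0 0) = even (w k 0)"
    using rep[rule_format, of 0] k hd[of 0] hd[of k]
    by (auto simp: tensor_color_def split: if_splits)
  then have "even k" using parity[of k 0] k n by auto
  then obtain q where q: "k = 2 * q" by auto
  with k have "q \<ge> 1" by simp
  have div2: "w i j = w i' j" if "w i j div 2 = w i' j div 2" "even i = even i'"
    "i < 2 * k" "i' < 2 * k" "j < n" for i i' j
    using parity[of i j] parity[of i' j] that by presburger
  \<comment> \<open>Restricted to times of the parity of \<open>a\<close>, the halved coordinate is
    a lazy walk of \<open>2 * q\<close> terms whose color sequence is a repetition. Halving loses
    nothing, since the parity of a coordinate is determined by that of the time.\<close>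
  have boring: "w a j = w (k + a) j"
    if a: "a \<le> 1" and j: "j < n"
      and c: "\<And>i. i < k \<Longrightarrow> even i = even a \<Longrightarrow>
        quaternary (w i j div 2) = quaternary (w (k + i) j div 2)" for a j
  proof -
    have "w (a + 2 * 0) j div 2 = w (a + 2 * (q + 0)) j div 2"
    proof (rule repetitive_lazy_walk_boring[where k = q and w = "\<lambda>i. w (a + 2 * i) j div 2",
          OF locally_injective_quaternary square_free_quaternary])
      fix i assume i: "Suc i < 2 * q"
      have "\<bar>w (Suc (a + 2 * i)) j - w (a + 2 * i) j\<bar> = 1"
        "\<bar>w (Suc (Suc (a + 2 * i))) j - w (Suc (a + 2 * i)) j\<bar> = 1"
        using step[of "a + 2 * i" j] step[of "Suc (a + 2 * i)" j] i a j q by auto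
      then show "\<bar>w (a + 2 * Suc i) j div 2 - w (a + 2 * i) j div 2\<bar> \<le> 1"
        by simp
    next
      fix i assume "i < q"
      then show "quaternary (w (a + 2 * i) j div 2) = quaternary (w (a + 2 * (q + i)) j div 2)"
        using c[of "a + 2 * i"] a q by (simp add: algebra_simps)
    qed (use \<open>q \<ge> 1\<close> in simp)
    then show ?thesis
      using div2[of a j "k + a"] a j q \<open>q \<ge> 1\<close> by (simp add: add.commute)
  qed
  \<comment> \<open>Of the times 0 and 1, \<open>a\<close> is the one with even first coordinate and
    \<open>b\<close> the other.\<close>
  obtain a b :: nat where ab: "a \<le> 1" "b = 1 - a" "even (w a 0)"
  proof (cases "even (w 0 0)")
    case True
    then show ?thesis using that[of 0 1] by simp
  next
    case False
    then have "even (w 1 0)" using parity[of 1 0] q \<open>q \<ge> 1\<close> n by simp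
    then show ?thesis using that[of 1 0] by simp
  qed
  have par_a: "even (w i 0) \<longleftrightarrow> even i = even a" if "i < 2 * k" for i
    using parity[of i 0] parity[of a 0] that ab n q \<open>q \<ge> 1\<close> by auto
  have even_time: "w a j = w (k + a) j" if "1 \<le> j" "j < n" for j
  proof (rule boring[OF ab(1) that(2)])
    fix i assume i: "i < k" "even i = even a"
    then have "even (w i 0)" "even (w (k + i) 0)" using par_a \<open>even k\<close> by auto
    with rep[rule_format, OF i(1)] i hd[of i] hd[of "k + i"]
      tl[of i "k + i" "\<lambda>y. quaternary (y div 2)"] that
    show "quaternary (w i j div 2) = quaternary (w (k + i) j div 2)"
      by (simp add: tensor_color_def)
  qed
  have b: "b \<le> 1" "even a \<noteq> even b" "b < k" using ab q \<open>q \<ge> 1\<close> by (auto simp: le_Suc_eq)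
  have odd_color: "quaternary (w i 0 div 2) = quaternary (w (k + i) 0 div 2) \<and>
      (\<forall>j. 1 \<le> j \<and> j < n \<longrightarrow> even (w i j div 2) = even (w (k + i) j div 2))"
    if i: "i < k" "even i = even b" for i
  proof -
    have "odd (w i 0)" "odd (w (k + i) 0)" using par_a \<open>even k\<close> b i by auto
    with rep[rule_format, OF i(1)] i hd[of i] hd[of "k + i"] tl[of i "k + i" "\<lambda>y. even (y div 2)"]
    show ?thesis
      by (simp add: tensor_color_def)
  qed
  \<comment> \<open>Agreement at time \<open>b\<close> suffices: it makes two vertices of the path
    equal.\<close>
  have "w b j = w (k + b) j" if "j < n" for j
  proof (cases "j = 0")
    case True
    show ?thesis unfolding True by (rule boring) (use b n odd_color in auto)
  next
    case False
    then have j: "1 \<le> j" "j < n" using that by auto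
    have "a = Suc b \<or> b = Suc a" using ab by auto
    then have "\<bar>w a j - w b j\<bar> = 1" "\<bar>w (k + a) j - w (k + b) j\<bar> = 1"
      using step[of a j] step[of b j] step[of "k + a" j] step[of "k + b" j] j ab(1) b q \<open>q \<ge> 1\<close>
      by (auto simp: abs_minus_commute)
    moreover have "even (w b j div 2) = even (w (k + b) j div 2)" using odd_color[of b] b j by simp
    moreover have "w a j = w (k + a) j" by (rule even_time[OF j])
    \<comment> \<open>Both values are at distance 1 from the same integer, so they are equal or
      differ by 2; in the latter case their halves would have different parity.\<close>
    ultimately show ?thesis by presburger
  qed
  then have "vs ! b = vs ! (k + b)"
    using length[of b] length[of "k + b"] b by (intro nth_equalityI) (auto simp: w_def)
  moreover have "distinct vs" using path by (simp add: vpath_def)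
  ultimately show False using b len k by (simp add: nth_eq_iff_index_eq)
qed

theorem theorem4:
  fixes n :: nat
  assumes "n \<ge> 1"
  shows "nonrep_number (tensor_power int_path n) \<le> enat (4 ^ (n - 1) + 4 * 2 ^ (n - 1))"
proof -
  define A where "A = {ys. set ys \<subseteq> {..<4 :: nat} \<and> length ys = n - 1}"
  define B where "B = {ys. set ys \<subseteq> (UNIV :: bool set) \<and> length ys = n - 1}"
  have fin: "finite A" "finite B"
    unfolding A_def B_def by (intro finite_lists_length_eq; simp)+
  have card: "card A = 4 ^ (n - 1)" "card B = 2 ^ (n - 1)"
    unfolding A_def B_def by (subst card_lists_length_eq; simp)+
  have "nonrep_colorable (tensor_power int_path n) (card (A <+> {..<4 :: nat} \<times> B))"
  proof (rule nonrep_colorable_card)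
    show "tensor_color ` pverts (tensor_power int_path n) \<subseteq> A <+> {..<4} \<times> B"
      by (auto simp: pverts_tensor_power_int_path tensor_color_def A_def B_def quaternary_less)
  qed (use fin assms nonrepetitive_tensor_color in auto)
  then show ?thesis
    using fin by (simp add: nonrep_number_le_iff card card_Plus card_cartesian_product)
qed

end
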